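(* The logic $\mathbf{S4D}$ is the D-logic of the class of all topological spaces; that is, for every bimodal formula $A$, one has $A\in\mathbf{S4D}$ if and only if $A$ is valid in every topological space.
   Context: Formulas are built by $\phi ::= p \mid \bot \mid \phi\to\phi \mid \Box\phi \mid [\neq]\phi$, with $p$ ranging over propositional letters; the other Boolean connectives are the usual abbreviations, $\Diamond A=\neg\Box\neg A$, $\langle\neq\rangle A=\neg[\neq]\neg A$, and $[\forall]A=[\neq]A\wedge A$. A (bimodal) logic is a set of formulas containing all classical tautologies, $\Box(p\to q)\to(\Box p\to\Box q)$ and $[\neq](p\to q)\to([\neq]p\to[\neq]q)$, and closed under Substitution, Modus Ponens, and the two Generalization rules $A/\Box A$ and $A/[\neq]A$. $\mathbf{K_2}$ is the minimal logic, and $L+\Gamma$ is the minimal logic containing the logic $L$ and the set of formulas $\Gamma$. $\mathbf{S4D}=\mathbf{K_2}+\{B_D,4_D^-,D_\Box,T_\Box,4_\Box\}$, where $B_D$ is $p\to[\neq]\langle\neq\rangle p$; $4_D^-$ is $(p\wedge[\neq]p)\to[\neq][\neq]p$; $D_\Box$ is $[\forall]p\to\Box p$; $T_\Box$ is $\Box p\to p$; $4_\Box$ is $\Box p\to\Box\Box p$. Topological semantics: a valuation $\theta$ on a topological space $\mathfrak X$ assigns to each propositional letter a subset of $\mathfrak X$. Truth at a point is defined by: $\mathfrak X,\theta,x\models p$ iff $x\in\theta(p)$; $\bot$ is never true; $\to$ is interpreted classically; $\mathfrak X,\theta,x\models\Box\phi$ iff there is a neighborhood $U$ of $x$ with $\mathfrak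 X,\theta,y\models\phi$ for all $y\in U$; $\mathfrak X,\theta,x\models[\neq]\phi$ iff $\mathfrak X,\theta,y\models\phi$ for all $y\neq x$. A formula is valid in $\mathfrak X$ if it is true at every point under every valuation. The D-logic of a class of spaces is the set of all formulas valid in all spaces of the class. *)

theory Defs
  imports "HOL-Analysis.Abstract_Topology"
begin

datatype fm =
    Atom nat
  | Bot  ("\<bottom>\<^sub>f")
  | Imp fm fm  (infixr "\<rightarrow>\<^sub>f" 55)
  | Box fm
  | BoxNeq fm

abbreviation Neg :: "fm \<Rightarrow> fm" where
  "Neg A \<equiv> A \<rightarrow>\<^sub>f \<bottom>\<^sub>f"

abbreviation Conj :: "fm \<Rightarrow> fm \<Rightarrow> fm"  (infixr "\<and>\<^sub>f" 60) where
  "A \<and>\<^sub>f B \<equiv> Neg (A \<rightarrow>\<^sub>f Neg B)"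

abbreviation DiaNeq :: "fm \<Rightarrow> fm" where
  "DiaNeq A \<equiv> Neg (BoxNeq (Neg A))"

abbreviation BoxAll :: "fm \<Rightarrow> fm" where
  "BoxAll A \<equiv> BoxNeq A \<and>\<^sub>f A"

primrec fm_subst :: "(nat \<Rightarrow> fm) \<Rightarrow> fm \<Rightarrow> fm" where
  "fm_subst s (Atom n) = s n"
| "fm_subst s \<bottom>\<^sub>f = \<bottom>\<^sub>f"
| "fm_subst s (A \<rightarrow>\<^sub>f B) = fm_subst s A \<rightarrow>\<^sub>f fm_subst s B"
| "fm_subst s (Box A) = Box (fm_subst s A)"
| "fm_subst s (BoxNeq A) = BoxNeq (fm_subst s A)"

text \<open>Boolean evaluation in which formulas \<open>Box A\<close> and \<open>BoxNeq A\<close> are treated like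
  letters: \<open>v\<close> assigns a truth value to them directly.\<close>

primrec bool_eval :: "(fm \<Rightarrow> bool) \<Rightarrow> fm \<Rightarrow> bool" where
  "bool_eval v (Atom n) = v (Atom n)"
| "bool_eval v \<bottom>\<^sub>f = False"
| "bool_eval v (A \<rightarrow>\<^sub>f B) = (bool_eval v A \<longrightarrow> bool_eval v B)"
| "bool_eval v (Box A) = v (Box A)"
| "bool_eval v (BoxNeq A) = v (BoxNeq A)"

definition tautology :: "fm \<Rightarrow> bool" where
  "tautology A \<longleftrightarrow> (\<forall>v. bool_eval v A)"

abbreviation letter_p :: fm where "letter_p \<equiv> Atom 0"
abbreviation letter_q :: fm where "letter_q \<equiv> Atom 1"

definition is_logic :: "fm set \<Rightarrow> bool" where
  "is_logic L \<longleftrightarrow>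
     (\<forall>A. tautology A \<longrightarrow> A \<in> L) \<and>
     Box (letter_p \<rightarrow>\<^sub>f letter_q) \<rightarrow>\<^sub>f Box letter_p \<rightarrow>\<^sub>f Box letter_q \<in> L \<and>
     BoxNeq (letter_p \<rightarrow>\<^sub>f letter_q) \<rightarrow>\<^sub>f BoxNeq letter_p \<rightarrow>\<^sub>f BoxNeq letter_q \<in> L \<and>
     (\<forall>s A. A \<in> L \<longrightarrow> fm_subst s A \<in> L) \<and>
     (\<forall>A B. A \<in> L \<longrightarrow> A \<rightarrow>\<^sub>f B \<in> L \<longrightarrow> B \<in> L) \<and>
     (\<forall>A. A \<in> L \<longrightarrow> Box A \<in> L) \<and>
     (\<forall>A. A \<in> L \<longrightarrow> BoxNeq A \<in> L)"

definition K2 :: "fm set" where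
  "K2 = \<Inter>{L. is_logic L}"

definition logic_plus :: "fm set \<Rightarrow> fm set \<Rightarrow> fm set"  (infixl "+\<^sub>L" 65) where
  "L +\<^sub>L \<Gamma> = \<Inter>{L'. is_logic L' \<and> L \<subseteq> L' \<and> \<Gamma> \<subseteq> L'}"

definition B_D :: fm where
  "B_D = letter_p \<rightarrow>\<^sub>f BoxNeq (DiaNeq letter_p)"

definition Four_D_minus :: fm where
  "Four_D_minus = (letter_p \<and>\<^sub>f BoxNeq letter_p) \<rightarrow>\<^sub>f BoxNeq (BoxNeq letter_p)"

definition D_Box :: fm where
  "D_Box = BoxAll letter_p \<rightarrow>\<^sub>f Box letter_p"

definition T_Box :: fm where
  "T_Box = Box letter_p \<rightarrow>\<^sub>f letter_p"

definition Four_Box :: fm where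
  "Four_Box = Box letter_p \<rightarrow>\<^sub>f Box (Box letter_p)"

definition S4D :: "fm set" where
  "S4D = K2 +\<^sub>L {B_D, Four_D_minus, D_Box, T_Box, Four_Box}"

text \<open>The points of the space are the elements of \<open>topspace X\<close>, which may be a proper
  subset of the type \<open>'a\<close>; \<open>[\<noteq>]\<close> ranges over these points only.\<close>

primrec top_truth :: "'a topology \<Rightarrow> (nat \<Rightarrow> 'a set) \<Rightarrow> 'a \<Rightarrow> fm \<Rightarrow> bool" where
  "top_truth X \<theta> x (Atom n) \<longleftrightarrow> x \<in> \<theta> n"
| "top_truth X \<theta> x \<bottom>\<^sub>f \<longleftrightarrow> False"
| "top_truth X \<theta> x (A \<rightarrow>\<^sub>f B) \<longleftrightarrow> (top_truth X \<theta> x A \<longrightarrow> top_truth X \<theta> x B)"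
| "top_truth X \<theta> x (Box A) \<longleftrightarrow> (\<exists>U. openin X U \<and> x \<in> U \<and> (\<forall>y\<in>U. top_truth X \<theta> y A))"
| "top_truth X \<theta> x (BoxNeq A) \<longleftrightarrow> (\<forall>y\<in>topspace X. y \<noteq> x \<longrightarrow> top_truth X \<theta> y A)"

definition top_valid :: "'a topology \<Rightarrow> fm \<Rightarrow> bool" where
  "top_valid X A \<longleftrightarrow>
     (\<forall>\<theta>. (\<forall>n. \<theta> n \<subseteq> topspace X) \<longrightarrow> (\<forall>x\<in>topspace X. top_truth X \<theta> x A))"

text \<open>A class of spaces is a set of topologies over one type \<open>'a\<close>, since HOL cannot quantify over
  types inside a formula. The class of all topological spaces is therefore rendered by
  \<open>UNIV :: 'a topology set\<close> for an arbitrary infinite type \<open>'a\<close>. Infinity is needed: over a finite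
  type the number of points is bounded, which validates formulas that are not valid in general.\<close>

definition D_logic :: "'a topology set \<Rightarrow> fm set" where
  "D_logic C = {A. \<forall>X\<in>C. top_valid X A}"

end

(* Completeness: refute a non-theorem in a maximal theory w0, restrict the canonical model to w0
   and its [\<noteq>]-successors W, where any two distinct points are [\<noteq>]-related, and filtrate W through
   the subformulas. A class that sees itself along [\<noteq>] is then replaced by two copies lying in the
   same cluster, so that [\<noteq>] becomes true inequality. The up-set topology of the resulting finite
   preorder is the countermodel; being finite, it fits into any infinite type. *)
theory Submission imports Defs begin

section \<open>Soundness\<close>

text \<open>Truth at a fixed point is itself a Boolean valuation of atoms and boxed formulas, which
  is why every tautology is valid.\<close>

lemma bool_eval_top_truth: "bool_eval (top_truth X \<theta> x) A \<longleftrightarrow> top_truth X \<theta> x A"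
  by (induction A) auto

text \<open>The truth sets of the substituted formulas form a new valuation. It is cut down to
  \<open>topspace X\<close> because \<open>top_valid\<close> admits only valuations by sets of
  points.\<close>

lemma top_truth_subst:
  assumes "x \<in> topspace X"
  shows "top_truth X \<theta> x (fm_subst s A) \<longleftrightarrow>
    top_truth X (\<lambda>n. {y \<in> topspace X. top_truth X \<theta> y (s n)}) x A"
  using assms
proof (induction A arbitrary: x)
  case (Box A)
  have "(\<forall>y\<in>U. top_truth X \<theta> y (fm_subst s A)) \<longleftrightarrow>
      (\<forall>y\<in>U. top_truth X (\<lambda>n. {y \<in> topspace X. top_truth X \<theta> y (s n)}) y A)"
    if "openin X U" for U
    using Box.IH openin_subset[OF that] by (intro ball_cong) auto
  then show ?case unfolding fm_subst.simps top_truth.simps by blast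
qed auto

lemma is_logic_top_valid: "is_logic {A. top_valid X A}"
  unfolding is_logic_def mem_Collect_eq
proof (intro conjI allI impI)
  fix A
  assume "tautology A"
  then have "top_truth X \<theta> x A" for \<theta> x
    using bool_eval_top_truth[of X \<theta> x A] by (simp add: tautology_def)
  then show "top_valid X A" by (simp add: top_valid_def)
next
  show "top_valid X (Box (letter_p \<rightarrow>\<^sub>f letter_q) \<rightarrow>\<^sub>f Box letter_p \<rightarrow>\<^sub>f Box letter_q)"
    unfolding top_valid_def
  proof (intro allI impI ballI)
    fix \<theta> x
    show "top_truth X \<theta> x (Box (letter_p \<rightarrow>\<^sub>f letter_q) \<rightarrow>\<^sub>f Box letter_p \<rightarrow>\<^sub>f Box letter_q)"
      unfolding top_truth.simps
    proof (intro impI, elim exE conjE)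
      fix U V
      assume "openin X U" "x \<in> U" "\<forall>y\<in>U. y \<in> \<theta> 0 \<longrightarrow> y \<in> \<theta> 1"
        "openin X V" "x \<in> V" "\<forall>y\<in>V. y \<in> \<theta> 0"
      then show "\<exists>W. openin X W \<and> x \<in> W \<and> (\<forall>y\<in>W. y \<in> \<theta> 1)"
        by (intro exI[of _ "U \<inter> V"]) (auto intro: openin_Int)
    qed
  qed
next
  show "top_valid X (BoxNeq (letter_p \<rightarrow>\<^sub>f letter_q) \<rightarrow>\<^sub>f BoxNeq letter_p \<rightarrow>\<^sub>f BoxNeq letter_q)"
    by (simp add: top_valid_def)
next
  fix s A
  assume A: "top_valid X A"
  show "top_valid X (fm_subst s A)"
    unfolding top_valid_def
  proof (intro allI impI ballI)
    fix \<theta> x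
    assume x: "x \<in> topspace X"
    define \<theta>' where "\<theta>' n = {y \<in> topspace X. top_truth X \<theta> y (s n)}" for n
    have "\<forall>n. \<theta>' n \<subseteq> topspace X" by (auto simp: \<theta>'_def)
    then have "top_truth X \<theta>' x A" using A x by (simp add: top_valid_def)
    then show "top_truth X \<theta> x (fm_subst s A)"
      by (simp add: top_truth_subst[OF x] \<theta>'_def[abs_def])
  qed
next
  fix A B
  assume "top_valid X A" "top_valid X (A \<rightarrow>\<^sub>f B)"
  then show "top_valid X B" by (simp add: top_valid_def)
next
  fix A
  assume "top_valid X A"
  then show "top_valid X (Box A)"
    unfolding top_valid_def top_truth.simps using openin_topspace by blast
next
  fix A
  assume "top_valid X A"
  then show "top_valid X (BoxNeq A)" by (simp add: top_valid_def)
qed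

lemma S4D_eq: "S4D = \<Inter>{L. is_logic L \<and> {B_D, Four_D_minus, D_Box, T_Box, Four_Box} \<subseteq> L}"
  unfolding S4D_def logic_plus_def K2_def by blast

lemma S4D_axioms_valid: "{B_D, Four_D_minus, D_Box, T_Box, Four_Box} \<subseteq> {A. top_valid X A}"
proof -
  have "top_valid X B_D" unfolding top_valid_def B_D_def by simp metis
  moreover have "top_valid X Four_D_minus" by (auto simp: top_valid_def Four_D_minus_def)
  \<comment> \<open>For \<open>D_Box\<close> the whole space serves as neighborhood; for
    \<open>Four_Box\<close> an open set witnesses the box at each of its own points.\<close>
  moreover have "top_valid X D_Box"
    unfolding top_valid_def D_Box_def top_truth.simps using openin_topspace[of X] by metis
  moreover have "top_valid X T_Box" "top_valid X Four_Box"
    unfolding top_valid_def T_Box_def Four_Box_def top_truth.simps by blast+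
  ultimately show ?thesis by blast
qed

lemma S4D_sound: "A \<in> S4D \<Longrightarrow> top_valid X A"
  using is_logic_top_valid[of X] S4D_axioms_valid[of X] unfolding S4D_eq by blast

section \<open>Maximal theories\<close>

lemma logic_tautology: "is_logic L \<Longrightarrow> (\<And>v. bool_eval v A) \<Longrightarrow> A \<in> L"
  unfolding is_logic_def tautology_def by blast

lemma logic_K_Box:
  "is_logic L \<Longrightarrow> Box (letter_p \<rightarrow>\<^sub>f letter_q) \<rightarrow>\<^sub>f Box letter_p \<rightarrow>\<^sub>f Box letter_q \<in> L"
  unfolding is_logic_def by (elim conjE)

lemma logic_K_BoxNeq:
  "is_logic L \<Longrightarrow> BoxNeq (letter_p \<rightarrow>\<^sub>f letter_q) \<rightarrow>\<^sub>f BoxNeq letter_p \<rightarrow>\<^sub>f BoxNeq letter_q \<in> L"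
  unfolding is_logic_def by (elim conjE)

lemma logic_subst: "is_logic L \<Longrightarrow> A \<in> L \<Longrightarrow> fm_subst s A \<in> L"
  unfolding is_logic_def by blast

lemma logic_mp: "is_logic L \<Longrightarrow> A \<rightarrow>\<^sub>f B \<in> L \<Longrightarrow> A \<in> L \<Longrightarrow> B \<in> L"
  unfolding is_logic_def by blast

lemma logic_Box: "is_logic L \<Longrightarrow> A \<in> L \<Longrightarrow> Box A \<in> L"
  unfolding is_logic_def by blast

lemma logic_BoxNeq: "is_logic L \<Longrightarrow> A \<in> L \<Longrightarrow> BoxNeq A \<in> L"
  unfolding is_logic_def by blast

lemma is_logic_Inter:
  assumes L: "\<And>L. L \<in> \<L> \<Longrightarrow> is_logic L"
  shows "is_logic (\<Inter>\<L>)"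
  unfolding is_logic_def
proof (intro conjI allI impI InterI)
  fix L A assume "tautology A" "L \<in> \<L>"
  then show "A \<in> L" using logic_tautology[OF L] by (simp add: tautology_def)
next
  fix L A B assume "A \<in> \<Inter>\<L>" "A \<rightarrow>\<^sub>f B \<in> \<Inter>\<L>" "L \<in> \<L>"
  then show "B \<in> L" using logic_mp[OF L, of L A B] by simp
\<comment> \<open>The simplifier turns \<open>Atom 1\<close> into \<open>Atom (Suc 0)\<close>, so
  both axioms are brought to that form.\<close>
qed (simp_all add: L logic_K_Box[unfolded One_nat_def] logic_K_BoxNeq[unfolded One_nat_def]
  logic_subst logic_Box logic_BoxNeq)

lemma is_logic_S4D: "is_logic S4D"
  unfolding S4D_eq by (rule is_logic_Inter) blast

text \<open>Closed under Modus Ponens only, not under Substitution or Generalization: such a set is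
  to describe what holds at one point.\<close>

definition theory_over :: "fm set \<Rightarrow> fm set \<Rightarrow> bool" where
  "theory_over L T \<longleftrightarrow> L \<subseteq> T \<and> (\<forall>A B. A \<in> T \<longrightarrow> A \<rightarrow>\<^sub>f B \<in> T \<longrightarrow> B \<in> T)"

definition maximal_theory :: "fm set \<Rightarrow> fm set \<Rightarrow> bool" where
  "maximal_theory L M \<longleftrightarrow> theory_over L M \<and> \<bottom>\<^sub>f \<notin> M \<and> (\<forall>A. A \<in> M \<or> Neg A \<in> M)"

lemma theory_over_mp: "theory_over L T \<Longrightarrow> A \<rightarrow>\<^sub>f B \<in> T \<Longrightarrow> A \<in> T \<Longrightarrow> B \<in> T"
  unfolding theory_over_def by blast

lemma theory_over_logic: "theory_over L T \<Longrightarrow> A \<in> L \<Longrightarrow> A \<in> T"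
  unfolding theory_over_def by blast

lemma theory_over_tautology:
  "is_logic L \<Longrightarrow> theory_over L T \<Longrightarrow> (\<And>v. bool_eval v A) \<Longrightarrow> A \<in> T"
  by (rule theory_over_logic[OF _ logic_tautology])

text \<open>By the deduction theorem this set is the theory generated by \<open>T\<close> and
  \<open>A\<close>; describing it through implications avoids a notion of derivation.\<close>

lemma theory_over_extend:
  assumes L: "is_logic L" and T: "theory_over L T"
  shows "theory_over L {C. A \<rightarrow>\<^sub>f C \<in> T}"
  unfolding theory_over_def
proof (intro conjI allI impI subsetI CollectI)
  fix C assume "C \<in> L"
  with T have "C \<in> T" by (rule theory_over_logic)
  moreover have "C \<rightarrow>\<^sub>f A \<rightarrow>\<^sub>f C \<in> T" by (rule theory_over_tautology[OF L T]) simp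
  ultimately show "A \<rightarrow>\<^sub>f C \<in> T" using theory_over_mp[OF T] by blast
next
  fix B C
  assume "B \<in> {C. A \<rightarrow>\<^sub>f C \<in> T}" "B \<rightarrow>\<^sub>f C \<in> {C. A \<rightarrow>\<^sub>f C \<in> T}"
  moreover have "(A \<rightarrow>\<^sub>f B) \<rightarrow>\<^sub>f (A \<rightarrow>\<^sub>f B \<rightarrow>\<^sub>f C) \<rightarrow>\<^sub>f A \<rightarrow>\<^sub>f C \<in> T"
    by (rule theory_over_tautology[OF L T]) simp
  ultimately show "A \<rightarrow>\<^sub>f C \<in> T" using theory_over_mp[OF T] by blast
qed

text \<open>Zorn's lemma is applied to the theories that contain \<open>T\<close> and omit
  \<open>B\<close>. A maximal one is consistent and decides every formula.\<close>

lemma lindenbaum: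
  assumes L: "is_logic L" and T: "theory_over L T" and B: "B \<notin> T"
  obtains M where "maximal_theory L M" "T \<subseteq> M" "B \<notin> M"
proof -
  define \<T> where "\<T> = {S. theory_over L S \<and> T \<subseteq> S \<and> B \<notin> S}"
  have "\<exists>M\<in>\<T>. \<forall>S\<in>\<T>. M \<subseteq> S \<longrightarrow> S = M"
  proof (rule subset_Zorn_nonempty)
    show "\<T> \<noteq> {}" using T B by (auto simp: \<T>_def)
  next
    fix \<C> assume ne: "\<C> \<noteq> {}" and ch: "subset.chain \<T> \<C>"
    have mem: "theory_over L S" "T \<subseteq> S" "B \<notin> S" if "S \<in> \<C>" for S
      using ch that by (auto simp: subset.chain_def \<T>_def)
    have "C \<in> \<Union>\<C>" if hA: "A \<in> \<Union>\<C>" and hAC: "A \<rightarrow>\<^sub>f C \<in> \<Union>\<C>" for A C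
    proof -
      obtain S1 S2 where "S1 \<in> \<C>" "A \<in> S1" "S2 \<in> \<C>" "A \<rightarrow>\<^sub>f C \<in> S2"
        using hA hAC by blast
      moreover from this have "S1 \<subseteq> S2 \<or> S2 \<subseteq> S1"
        using ch by (auto simp: subset_chain_def)
      ultimately obtain S where "S \<in> \<C>" "A \<in> S" "A \<rightarrow>\<^sub>f C \<in> S" by blast
      then show ?thesis using theory_over_mp[OF mem(1)] by blast
    qed
    moreover have "L \<subseteq> \<Union>\<C>" using ne mem(1) unfolding theory_over_def by blast
    ultimately have "theory_over L (\<Union>\<C>)" unfolding theory_over_def by blast
    moreover have "T \<subseteq> \<Union>\<C>" "B \<notin> \<Union>\<C>" using ne mem(2,3) by blast+
    ultimately show "\<Union>\<C> \<in> \<T>" by (simp add: \<T>_def)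
  qed
  then obtain M where "M \<in> \<T>" and M_max: "\<And>S. S \<in> \<T> \<Longrightarrow> M \<subseteq> S \<Longrightarrow> S = M" by blast
  then have M: "theory_over L M" "T \<subseteq> M" "B \<notin> M" by (simp_all add: \<T>_def)
  then have max: "S = M" if "theory_over L S" "M \<subseteq> S" "B \<notin> S" for S
    using that M_max[of S] by (auto simp: \<T>_def)
  \<comment> \<open>By maximality, the extension of \<open>M\<close> by a missing formula
    \<open>A\<close> has to contain \<open>B\<close>.\<close>
  have imp: "A \<rightarrow>\<^sub>f B \<in> M" if "A \<notin> M" for A
  proof (rule ccontr)
    assume "A \<rightarrow>\<^sub>f B \<notin> M"
    moreover have "M \<subseteq> {C. A \<rightarrow>\<^sub>f C \<in> M}"
    proof
      fix C assume "C \<in> M"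
      moreover have "C \<rightarrow>\<^sub>f A \<rightarrow>\<^sub>f C \<in> M" by (rule theory_over_tautology[OF L M(1)]) simp
      ultimately show "C \<in> {C. A \<rightarrow>\<^sub>f C \<in> M}" using theory_over_mp[OF M(1)] by blast
    qed
    ultimately have "{C. A \<rightarrow>\<^sub>f C \<in> M} = M"
      using max[OF theory_over_extend[OF L M(1)]] by blast
    moreover have "A \<rightarrow>\<^sub>f A \<in> M" by (rule theory_over_tautology[OF L M(1)]) simp
    ultimately show False using that by blast
  qed
  have "\<bottom>\<^sub>f \<rightarrow>\<^sub>f B \<in> M" by (rule theory_over_tautology[OF L M(1)]) simp
  then have "\<bottom>\<^sub>f \<notin> M" using theory_over_mp[OF M(1)] M(3) by blast
  moreover have "A \<in> M \<or> Neg A \<in> M" for A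
  proof -
    \<comment> \<open>If \<open>A\<close> and \<open>Neg A\<close> were both missing, each would
      imply \<open>B\<close> within \<open>M\<close>, and arguing by cases would put
      \<open>B\<close> into \<open>M\<close>.\<close>
    have "(A \<rightarrow>\<^sub>f B) \<rightarrow>\<^sub>f (Neg A \<rightarrow>\<^sub>f B) \<rightarrow>\<^sub>f B \<in> M"
      by (rule theory_over_tautology[OF L M(1)]) auto
    then show ?thesis using imp theory_over_mp[OF M(1)] M(3) by blast
  qed
  ultimately have "maximal_theory L M" using M(1) unfolding maximal_theory_def by blast
  then show thesis using that M by blast
qed

lemma maximal_theory_logic: "maximal_theory L M \<Longrightarrow> A \<in> L \<Longrightarrow> A \<in> M"
  unfolding maximal_theory_def theory_over_def by blast

lemma maximal_theory_Bot: "maximal_theory L M \<Longrightarrow> \<bottom>\<^sub>f \<notin> M"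
  unfolding maximal_theory_def by blast

lemma maximal_theory_Imp:
  assumes L: "is_logic L" and M: "maximal_theory L M"
  shows "A \<rightarrow>\<^sub>f B \<in> M \<longleftrightarrow> (A \<in> M \<longrightarrow> B \<in> M)"
proof -
  have T: "theory_over L M" using M by (simp add: maximal_theory_def)
  have "B \<rightarrow>\<^sub>f A \<rightarrow>\<^sub>f B \<in> M" "Neg A \<rightarrow>\<^sub>f A \<rightarrow>\<^sub>f B \<in> M"
    by (rule theory_over_tautology[OF L T]; simp)+
  moreover have "A \<in> M \<or> Neg A \<in> M" using M by (simp add: maximal_theory_def)
  ultimately show ?thesis using theory_over_mp[OF T] by blast
qed

text \<open>A proper inclusion would put some formula together with its negation into
  \<open>N\<close>; hence the separating formula can be found on the prescribed side.\<close>

lemma maximal_theory_separate: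
  assumes L: "is_logic L" and "maximal_theory L M" "maximal_theory L N" "M \<noteq> N"
  obtains E where "E \<in> M" "E \<notin> N"
proof -
  have "\<not> M \<subseteq> N"
  proof
    assume "M \<subseteq> N"
    with assms obtain A where A: "A \<in> N" "A \<notin> M" by blast
    then have "Neg A \<in> N" using assms \<open>M \<subseteq> N\<close> unfolding maximal_theory_def by blast
    then show False using A maximal_theory_Imp[OF L assms(3)] maximal_theory_Bot[OF assms(3)] by blast
  qed
  then show thesis using that by blast
qed

section \<open>Canonical relations\<close>

text \<open>What \<open>Box\<close> and \<open>BoxNeq\<close> share, so that the canonical model
  argument is made once for both.\<close>

definition normal_modality :: "fm set \<Rightarrow> (fm \<Rightarrow> fm) \<Rightarrow> bool" where
  "normal_modality L m \<longleftrightarrow> (\<forall>A B. m (A \<rightarrow>\<^sub>f B) \<rightarrow>\<^sub>f m A \<rightarrow>\<^sub>f m B \<in> L) \<and> (\<forall>A. A \<in> L \<longrightarrow> m A \<in> L)"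

definition canonical_rel :: "(fm \<Rightarrow> fm) \<Rightarrow> fm set \<Rightarrow> fm set \<Rightarrow> bool" where
  "canonical_rel m M N \<longleftrightarrow> (\<forall>C. m C \<in> M \<longrightarrow> C \<in> N)"

lemma normal_modality_Box:
  assumes L: "is_logic L"
  shows "normal_modality L Box"
  unfolding normal_modality_def
proof (intro conjI allI impI)
  fix A B
  from logic_subst[OF L logic_K_Box[OF L], of "\<lambda>n. if n = 0 then A else B"]
  show "Box (A \<rightarrow>\<^sub>f B) \<rightarrow>\<^sub>f Box A \<rightarrow>\<^sub>f Box B \<in> L" by simp
qed (rule logic_Box[OF L])

lemma normal_modality_BoxNeq:
  assumes L: "is_logic L"
  shows "normal_modality L BoxNeq"
  unfolding normal_modality_def
proof (intro conjI allI impI)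
  fix A B
  from logic_subst[OF L logic_K_BoxNeq[OF L], of "\<lambda>n. if n = 0 then A else B"]
  show "BoxNeq (A \<rightarrow>\<^sub>f B) \<rightarrow>\<^sub>f BoxNeq A \<rightarrow>\<^sub>f BoxNeq B \<in> L" by simp
qed (rule logic_BoxNeq[OF L])

text \<open>Axiom K and Generalization make the formulas boxed in \<open>M\<close> a theory. It
  omits \<open>B\<close>, so it extends to a maximal theory that still omits
  \<open>B\<close>.\<close>

lemma canonical_witness:
  assumes L: "is_logic L" and m: "normal_modality L m"
    and M: "maximal_theory L M" and "m B \<notin> M"
  obtains N where "maximal_theory L N" "canonical_rel m M N" "B \<notin> N"
proof -
  have "theory_over L {C. m C \<in> M}"
    unfolding theory_over_def
  proof (intro conjI allI impI subsetI CollectI)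
    fix A C assume "A \<in> {C. m C \<in> M}" "A \<rightarrow>\<^sub>f C \<in> {C. m C \<in> M}"
    moreover have "m (A \<rightarrow>\<^sub>f C) \<rightarrow>\<^sub>f m A \<rightarrow>\<^sub>f m C \<in> M"
      using m maximal_theory_logic[OF M] unfolding normal_modality_def by blast
    ultimately show "m C \<in> M" using maximal_theory_Imp[OF L M] by blast
  qed (use m maximal_theory_logic[OF M] in \<open>unfold normal_modality_def, blast\<close>)
  then obtain N where "maximal_theory L N" "{C. m C \<in> M} \<subseteq> N" "B \<notin> N"
    using lindenbaum[OF L] assms(4) by blast
  then show thesis using that by (auto simp: canonical_rel_def)
qed

lemma maximal_theory_modality_mono:
  assumes L: "is_logic L" and m: "normal_modality L m"
    and M: "maximal_theory L M" and "m A \<in> M" and "\<And>v. bool_eval v (A \<rightarrow>\<^sub>f B)"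
  shows "m B \<in> M"
proof -
  have "A \<rightarrow>\<^sub>f B \<in> L" using L assms(5) by (rule logic_tautology)
  then have "m (A \<rightarrow>\<^sub>f B) \<in> L" "m (A \<rightarrow>\<^sub>f B) \<rightarrow>\<^sub>f m A \<rightarrow>\<^sub>f m B \<in> L"
    using m unfolding normal_modality_def by blast+
  then have "m A \<rightarrow>\<^sub>f m B \<in> L" using logic_mp[OF L] by blast
  then show ?thesis using maximal_theory_logic[OF M] maximal_theory_Imp[OF L M] assms(4) by blast
qed

section \<open>Conditions that the axioms of \<open>S4D\<close> impose on the canonical
  relations\<close>

abbreviation S4D_point :: "fm set \<Rightarrow> bool" where
  "S4D_point \<equiv> maximal_theory S4D"

lemmas S4D_point_Imp = maximal_theory_Imp[OF is_logic_S4D]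
lemmas S4D_BoxNeq = normal_modality_BoxNeq[OF is_logic_S4D]
lemmas S4D_Box = normal_modality_Box[OF is_logic_S4D]

text \<open>Each axiom has a single letter, so a constant substitution yields all instances.\<close>

lemma S4D_axiom_instances:
  shows S4D_B: "C \<rightarrow>\<^sub>f BoxNeq (DiaNeq C) \<in> S4D"
    and S4D_4D: "(C \<and>\<^sub>f BoxNeq C) \<rightarrow>\<^sub>f BoxNeq (BoxNeq C) \<in> S4D"
    and S4D_D: "BoxAll C \<rightarrow>\<^sub>f Box C \<in> S4D"
    and S4D_T: "Box C \<rightarrow>\<^sub>f C \<in> S4D"
    and S4D_4: "Box C \<rightarrow>\<^sub>f Box (Box C) \<in> S4D"
proof -
  have "{B_D, Four_D_minus, D_Box, T_Box, Four_Box} \<subseteq> S4D" unfolding S4D_eq by blast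
  then have "fm_subst (\<lambda>_. C) ` {B_D, Four_D_minus, D_Box, T_Box, Four_Box} \<subseteq> S4D"
    using logic_subst[OF is_logic_S4D] by blast
  then show "C \<rightarrow>\<^sub>f BoxNeq (DiaNeq C) \<in> S4D"
    and "(C \<and>\<^sub>f BoxNeq C) \<rightarrow>\<^sub>f BoxNeq (BoxNeq C) \<in> S4D"
    and "BoxAll C \<rightarrow>\<^sub>f Box C \<in> S4D"
    and "Box C \<rightarrow>\<^sub>f C \<in> S4D"
    and "Box C \<rightarrow>\<^sub>f Box (Box C) \<in> S4D"
    by (simp_all add: B_D_def Four_D_minus_def D_Box_def T_Box_def Four_Box_def)
qed

lemma S4D_point_T: "S4D_point x \<Longrightarrow> Box C \<in> x \<Longrightarrow> C \<in> x"
  using maximal_theory_logic[OF _ S4D_T] S4D_point_Imp by blast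

lemma S4D_point_4: "S4D_point x \<Longrightarrow> Box C \<in> x \<Longrightarrow> Box (Box C) \<in> x"
  using maximal_theory_logic[OF _ S4D_4] S4D_point_Imp by blast

lemma S4D_point_4D: "S4D_point x \<Longrightarrow> C \<in> x \<Longrightarrow> BoxNeq C \<in> x \<Longrightarrow> BoxNeq (BoxNeq C) \<in> x"
  using maximal_theory_logic[OF _ S4D_4D] S4D_point_Imp maximal_theory_Bot by metis

lemma S4D_point_D: "S4D_point x \<Longrightarrow> C \<in> x \<Longrightarrow> BoxNeq C \<in> x \<Longrightarrow> Box C \<in> x"
  using maximal_theory_logic[OF _ S4D_D] S4D_point_Imp maximal_theory_Bot by metis

lemma canonical_BoxNeq_sym:
  assumes x: "S4D_point x" and y: "S4D_point y" and xy: "canonical_rel BoxNeq x y"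
  shows "canonical_rel BoxNeq y x"
  unfolding canonical_rel_def
proof (intro allI impI, rule ccontr)
  fix C assume C: "BoxNeq C \<in> y" "C \<notin> x"
  then have "Neg C \<in> x" using S4D_point_Imp[OF x] by blast
  then have "BoxNeq (DiaNeq (Neg C)) \<in> x"
    using maximal_theory_logic[OF x S4D_B] S4D_point_Imp[OF x] by blast
  then have "DiaNeq (Neg C) \<in> y" using xy by (auto simp: canonical_rel_def)
  then have "BoxNeq (Neg (Neg C)) \<notin> y" using S4D_point_Imp[OF y] maximal_theory_Bot[OF y] by blast
  \<comment> \<open>Unfolding \<open>DiaNeq\<close> leaves a double negation below the box, which
    has to be introduced there.\<close>
  moreover have "BoxNeq (Neg (Neg C)) \<in> y"
    by (rule maximal_theory_modality_mono[OF is_logic_S4D S4D_BoxNeq y C(1)]) simp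
  ultimately show False by blast
qed

text \<open>The formula \<open>F\<close> is a disjunction of \<open>C\<close> with a formula separating \<open>x\<close> from \<open>z\<close>; it turns
  distinctness of points into an instance of the premise \<open>p \<and> [\<noteq>]p\<close> of the axioms.\<close>

lemma not_canonical_BoxNeq_witness:
  assumes x: "S4D_point x" and z: "S4D_point z"
    and "x \<noteq> z" and "\<not> canonical_rel BoxNeq x z"
  obtains F where "F \<in> x" "BoxNeq F \<in> x" "F \<notin> z"
proof -
  obtain E where E: "E \<in> x" "E \<notin> z"
    using maximal_theory_separate[OF is_logic_S4D x z \<open>x \<noteq> z\<close>] .
  obtain C where C: "BoxNeq C \<in> x" "C \<notin> z"
    using assms(4) by (auto simp: canonical_rel_def)
  show thesis
  proof (rule that)
    show "Neg C \<rightarrow>\<^sub>f E \<in> x" using E S4D_point_Imp[OF x] by blast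
    show "BoxNeq (Neg C \<rightarrow>\<^sub>f E) \<in> x"
      by (rule maximal_theory_modality_mono[OF is_logic_S4D S4D_BoxNeq x C(1)]) simp
    show "Neg C \<rightarrow>\<^sub>f E \<notin> z" using E C S4D_point_Imp[OF z] by blast
  qed
qed

text \<open>\<open>Four_D_minus\<close> boxes \<open>F\<close> twice at \<open>x\<close>, so
  \<open>F\<close> would reach \<open>z\<close> along the two steps.\<close>

lemma canonical_BoxNeq_pseudo_trans:
  assumes x: "S4D_point x" and z: "S4D_point z"
    and xy: "canonical_rel BoxNeq x y" and yz: "canonical_rel BoxNeq y z" and "x \<noteq> z"
  shows "canonical_rel BoxNeq x z"
proof (rule ccontr)
  assume "\<not> ?thesis"
  then obtain F where F: "F \<in> x" "BoxNeq F \<in> x" "F \<notin> z"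
    using not_canonical_BoxNeq_witness[OF x z \<open>x \<noteq> z\<close>] by blast
  then have "BoxNeq (BoxNeq F) \<in> x" using S4D_point_4D[OF x] by blast
  then show False using xy yz F by (auto simp: canonical_rel_def)
qed

text \<open>\<open>D_Box\<close> turns the separating \<open>F\<close> into \<open>Box F\<close> at
  \<open>x\<close>, so \<open>F\<close> would hold at \<open>y\<close>.\<close>

lemma canonical_Box_imp_BoxNeq:
  assumes x: "S4D_point x" and y: "S4D_point y"
    and xy: "canonical_rel Box x y" and "x \<noteq> y"
  shows "canonical_rel BoxNeq x y"
proof (rule ccontr)
  assume "\<not> ?thesis"
  then obtain F where F: "F \<in> x" "BoxNeq F \<in> x" "F \<notin> y"
    using not_canonical_BoxNeq_witness[OF x y \<open>x \<noteq> y\<close>] by blast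
  then have "Box F \<in> x" using S4D_point_D[OF x] by blast
  then show False using xy F by (auto simp: canonical_rel_def)
qed

section \<open>The up-set topology of a preorder\<close>

text \<open>The Alexandrov topology of \<open>r\<close> on \<open>D\<close>.\<close>

definition upset_topology :: "'a set \<Rightarrow> ('a \<Rightarrow> 'a \<Rightarrow> bool) \<Rightarrow> 'a topology" where
  "upset_topology D r = topology (\<lambda>U. U \<subseteq> D \<and> (\<forall>x\<in>U. \<forall>y\<in>D. r x y \<longrightarrow> y \<in> U))"

lemma openin_upset_topology:
  "openin (upset_topology D r) U \<longleftrightarrow> U \<subseteq> D \<and> (\<forall>x\<in>U. \<forall>y\<in>D. r x y \<longrightarrow> y \<in> U)"
proof -
  have "istopology (\<lambda>U. U \<subseteq> D \<and> (\<forall>x\<in>U. \<forall>y\<in>D. r x y \<longrightarrow> y \<in> U))"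
    unfolding istopology_def by blast
  then show ?thesis by (simp add: upset_topology_def topology_inverse')
qed

lemma topspace_upset_topology [simp]: "topspace (upset_topology D r) = D"
  unfolding topspace_def openin_upset_topology by blast

text \<open>The \<open>r\<close>-successors of \<open>x\<close> form its least open neighborhood, so
  the topological box agrees with the Kripke box.\<close>

lemma top_truth_upset_Box:
  assumes "x \<in> D" and refl: "r x x" and trans: "\<And>x y z. r x y \<Longrightarrow> r y z \<Longrightarrow> r x z"
  shows "top_truth (upset_topology D r) \<theta> x (Box A) \<longleftrightarrow>
    (\<forall>y\<in>D. r x y \<longrightarrow> top_truth (upset_topology D r) \<theta> y A)"
proof
  assume R: "\<forall>y\<in>D. r x y \<longrightarrow> top_truth (upset_topology D r) \<theta> y A"
  have "openin (upset_topology D r) {y \<in> D. r x y}"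
    unfolding openin_upset_topology using trans by blast
  then show "top_truth (upset_topology D r) \<theta> x (Box A)"
    using assms(1) refl R by (auto intro!: exI[of _ "{y \<in> D. r x y}"])
qed (use assms(1) in \<open>auto simp: openin_upset_topology\<close>)

section \<open>The finite countermodel\<close>

primrec subfm :: "fm \<Rightarrow> fm set" where
  "subfm (Atom n) = {Atom n}"
| "subfm \<bottom>\<^sub>f = {\<bottom>\<^sub>f}"
| "subfm (A \<rightarrow>\<^sub>f B) = insert (A \<rightarrow>\<^sub>f B) (subfm A \<union> subfm B)"
| "subfm (Box A) = insert (Box A) (subfm A)"
| "subfm (BoxNeq A) = insert (BoxNeq A) (subfm A)"

lemma finite_subfm: "finite (subfm A)"
  by (induction A) auto

lemma subfm_self: "A \<in> subfm A"
  by (cases A) auto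

lemma subfm_trans: "B \<in> subfm A \<Longrightarrow> subfm B \<subseteq> subfm A"
  by (induction A) auto

lemma S4D_countermodel:
  assumes inf: "infinite (UNIV :: 'a set)" and "A \<notin> S4D"
  shows "\<exists>X :: 'a topology. \<not> top_valid X A"
proof -
  have "theory_over S4D S4D"
    unfolding theory_over_def using logic_mp[OF is_logic_S4D] by blast
  then obtain w0 where w0: "S4D_point w0" "A \<notin> w0"
    using lindenbaum[OF is_logic_S4D] assms(2) by blast
  define \<Sigma> where "\<Sigma> = subfm A"
  define RD where "RD = canonical_rel BoxNeq"
  define W where "W = {w. S4D_point w \<and> (w = w0 \<or> RD w0 w)}"
  have point: "S4D_point w" if "w \<in> W" for w using that by (simp add: W_def)
  \<comment> \<open>A successor of a successor of \<open>w0\<close> is \<open>w0\<close> or again a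
    successor of \<open>w0\<close>, by pseudo-transitivity.\<close>
  have RD_W: "v \<in> W" if "w \<in> W" "S4D_point v" "RD w v" for w v
    using that canonical_BoxNeq_pseudo_trans[OF w0(1) that(2)] unfolding W_def RD_def by blast
  \<comment> \<open>Symmetry leads from \<open>w\<close> back to \<open>w0\<close>, and
    pseudo-transitivity on to \<open>v\<close>, as the two differ.\<close>
  have W_RD: "RD w v" if "w \<in> W" "v \<in> W" "w \<noteq> v" for w v
    using that canonical_BoxNeq_pseudo_trans canonical_BoxNeq_sym w0(1)
    unfolding W_def RD_def by blast
  have R_W: "v \<in> W" if "w \<in> W" "S4D_point v" "canonical_rel Box w v" for w v
    using that canonical_Box_imp_BoxNeq[OF point[OF that(1)] that(2)] RD_W RD_def by blast

  \<comment> \<open>A loop of the filtrated relation: two different theories with the same trace on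
    \<open>\<Sigma>\<close> also produce one.\<close>
  define looping where
    "looping S \<longleftrightarrow> (\<exists>u\<in>W. \<exists>v\<in>W. u \<inter> \<Sigma> = S \<and> v \<inter> \<Sigma> = S \<and> RD u v)" for S
  \<comment> \<open>The tag \<open>b\<close> numbers the copies: every trace occurs with
    \<open>False\<close>, and looping traces also with \<open>True\<close>.\<close>
  define P where "P = {(S, b). (\<exists>w\<in>W. S = w \<inter> \<Sigma>) \<and> (b \<longrightarrow> looping S)}"
  have "finite P"
  proof (rule finite_subset)
    show "P \<subseteq> Pow \<Sigma> \<times> UNIV" by (auto simp: P_def)
    show "finite (Pow \<Sigma> \<times> (UNIV :: bool set))" by (simp add: \<Sigma>_def finite_subfm)
  qed
  \<comment> \<open>The finite set \<open>P\<close> is transported into the given type along a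
    bijection \<open>g\<close>.\<close>
  obtain D :: "'a set" where D: "finite D" "card D = card P"
    using infinite_arbitrarily_large[OF inf] by blast
  then obtain g where g: "bij_betw g D P"
    using finite_same_card_bij[OF _ \<open>finite P\<close>] by blast
  define t where "t x = fst (g x)" for x
  \<comment> \<open>A transitive filtration: comparing boxed subformulas gives a preorder outright,
    and it ignores the tags, so both copies share a cluster.\<close>
  define r where "r x y \<longleftrightarrow> (\<forall>B. Box B \<in> t x \<longrightarrow> Box B \<in> t y)" for x y
  define X where "X = upset_topology D r"
  define \<theta> where "\<theta> n = {x \<in> D. Atom n \<in> t x}" for n

  have t_W: "\<exists>w\<in>W. t x = w \<inter> \<Sigma>" if "x \<in> D" for x
  proof -
    have "(t x, snd (g x)) \<in> P" using bij_betwE[OF g] that by (simp add: t_def)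
    then show ?thesis by (simp add: P_def)
  qed
  have preimage: "\<exists>x\<in>D. g x = p" if "p \<in> P" for p
    using bij_betw_imp_surj_on[OF g] that by blast
  have W_t: "\<exists>x\<in>D. t x = w \<inter> \<Sigma>" if "w \<in> W" for w
  proof -
    have "(w \<inter> \<Sigma>, False) \<in> P" using that by (auto simp: P_def)
    from preimage[OF this] show ?thesis unfolding t_def by (metis fst_conv)
  qed
  have two_copies: "\<exists>y\<in>D. y \<noteq> x \<and> t y = t x" if "x \<in> D" "looping (t x)" for x
  proof -
    \<comment> \<open>Flipping the tag gives the other copy, since a looping trace admits both
      tags.\<close>
    have "(t x, \<not> snd (g x)) \<in> P" using that t_W by (simp add: P_def)
    then obtain y where y: "y \<in> D" "g y = (t x, \<not> snd (g x))" using preimage by blast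
    then have "y \<noteq> x" by (metis snd_conv)
    then show ?thesis using y unfolding t_def by (metis fst_conv)
  qed
  have same_t: "looping (t x)" if "x \<in> D" "y \<in> D" "x \<noteq> y" "t x = t y" for x y
  proof -
    have "(t x, snd (g x)) \<in> P" "(t x, snd (g y)) \<in> P"
      using bij_betwE[OF g] that by (metis prod.collapse t_def)+
    moreover have "g x \<noteq> g y"
      using bij_betw_imp_inj_on[OF g] that by (auto simp: inj_on_def)
    \<comment> \<open>Equal traces force different tags, and the tag \<open>True\<close> is reserved
      for looping traces.\<close>
    then have "snd (g x) \<or> snd (g y)" using that(4) by (auto simp: t_def prod_eq_iff)
    ultimately show ?thesis by (auto simp: P_def)
  qed

  have truth: "top_truth X \<theta> x B \<longleftrightarrow> B \<in> t x" if "B \<in> \<Sigma>" "x \<in> D" for B x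
    using that
  proof (induction B arbitrary: x)
    case (Atom n)
    then show ?case by (simp add: \<theta>_def)
  next
    case Bot
    then show ?case using t_W maximal_theory_Bot[OF point] by fastforce
  next
    case (Imp B C)
    obtain w where w: "w \<in> W" "t x = w \<inter> \<Sigma>" using t_W Imp.prems by blast
    have "B \<in> \<Sigma>" "C \<in> \<Sigma>"
      using subfm_trans Imp.prems(1) subfm_self unfolding \<Sigma>_def by fastforce+
    then show ?case using Imp w S4D_point_Imp[OF point[OF w(1)]] by simp
  next
    case (Box B)
    obtain w where w: "w \<in> W" "t x = w \<inter> \<Sigma>" using t_W Box.prems by blast
    have B: "B \<in> \<Sigma>" using subfm_trans Box.prems(1) subfm_self unfolding \<Sigma>_def by fastforce
    have "top_truth X \<theta> x (Box B) \<longleftrightarrow> (\<forall>y\<in>D. r x y \<longrightarrow> top_truth X \<theta> y B)"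
      unfolding X_def by (rule top_truth_upset_Box) (use Box.prems in \<open>auto simp: r_def\<close>)
    also have "\<dots> \<longleftrightarrow> (\<forall>y\<in>D. r x y \<longrightarrow> B \<in> t y)" using Box.IH B by blast
    also have "\<dots> \<longleftrightarrow> Box B \<in> t x"
    proof
      assume "Box B \<in> t x"
      then show "\<forall>y\<in>D. r x y \<longrightarrow> B \<in> t y"
        using t_W B S4D_point_T[OF point] unfolding r_def by fastforce
    next
      assume all: "\<forall>y\<in>D. r x y \<longrightarrow> B \<in> t y"
      show "Box B \<in> t x"
      proof (rule ccontr)
        assume "Box B \<notin> t x"
        then have "Box B \<notin> w" using w Box.prems by blast
        then obtain v where v: "S4D_point v" "canonical_rel Box w v" "B \<notin> v"
          using canonical_witness[OF is_logic_S4D S4D_Box point[OF w(1)]] by blast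
        then obtain y where y: "y \<in> D" "t y = v \<inter> \<Sigma>" using W_t R_W[OF w(1)] by blast
        \<comment> \<open>By axiom 4, \<open>Box C\<close> in \<open>w\<close> yields
          \<open>Box (Box C)\<close> in \<open>w\<close>, hence \<open>Box C\<close> in
          \<open>v\<close>.\<close>
        have "r x y"
          using w y v(2) S4D_point_4[OF point[OF w(1)]] unfolding r_def canonical_rel_def by auto
        then show False using all y v(3) by blast
      qed
    qed
    finally show ?case .
  next
    case (BoxNeq B)
    obtain w where w: "w \<in> W" "t x = w \<inter> \<Sigma>" using t_W BoxNeq.prems by blast
    have B: "B \<in> \<Sigma>" using subfm_trans BoxNeq.prems(1) subfm_self unfolding \<Sigma>_def by fastforce
    have "top_truth X \<theta> x (BoxNeq B) \<longleftrightarrow> (\<forall>y\<in>D. y \<noteq> x \<longrightarrow> B \<in> t y)"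
      using BoxNeq.IH B by (simp add: X_def)
    also have "\<dots> \<longleftrightarrow> BoxNeq B \<in> t x"
    proof
      assume box: "BoxNeq B \<in> t x"
      show "\<forall>y\<in>D. y \<noteq> x \<longrightarrow> B \<in> t y"
      proof (intro ballI impI)
        fix y assume y: "y \<in> D" "y \<noteq> x"
        \<comment> \<open>The representatives may have to differ from \<open>w\<close>: for two
          copies of one trace, only some pair in that class is known to be related.\<close>
        obtain u v where "u \<in> W" "v \<in> W" "u \<inter> \<Sigma> = t x" "v \<inter> \<Sigma> = t y" "RD u v"
        proof (cases "t x = t y")
          case True
          then show thesis using same_t[of x y] BoxNeq.prems y that unfolding looping_def by metis
        next
          case False
          obtain v where "v \<in> W" "t y = v \<inter> \<Sigma>" using t_W y by blast
          moreover from this have "RD w v" using W_RD w False by blast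
          ultimately show thesis using that w by blast
        qed
        then show "B \<in> t y" using box B unfolding RD_def canonical_rel_def by blast
      qed
    next
      assume all: "\<forall>y\<in>D. y \<noteq> x \<longrightarrow> B \<in> t y"
      show "BoxNeq B \<in> t x"
      proof (rule ccontr)
        assume "BoxNeq B \<notin> t x"
        then have "BoxNeq B \<notin> w" using w BoxNeq.prems by blast
        then obtain v where v: "S4D_point v" "RD w v" "B \<notin> v"
          using canonical_witness[OF is_logic_S4D S4D_BoxNeq point[OF w(1)]] RD_def by blast
        then have "v \<in> W" using RD_W w by blast
        \<comment> \<open>A witness with the trace of \<open>x\<close> makes that trace looping, and
          the second copy of \<open>x\<close> replaces it; any other trace already gives a point
          different from \<open>x\<close>.\<close>
        obtain y where "y \<in> D" "y \<noteq> x" "t y = v \<inter> \<Sigma>"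
        proof (cases "v \<inter> \<Sigma> = t x")
          case True
          then have "looping (t x)" using w \<open>v \<in> W\<close> v(2) unfolding looping_def by blast
          then show thesis using two_copies BoxNeq.prems True that by metis
        next
          case False
          then show thesis using W_t[OF \<open>v \<in> W\<close>] that by metis
        qed
        then show False using all v(3) by blast
      qed
    qed
    finally show ?case .
  qed

  have "w0 \<in> W" using w0 by (simp add: W_def)
  then obtain x where x: "x \<in> D" "t x = w0 \<inter> \<Sigma>" using W_t by blast
  have "\<not> top_truth X \<theta> x A"
    using truth[of A x] x w0(2) subfm_self by (simp add: \<Sigma>_def)
  moreover have "\<forall>n. \<theta> n \<subseteq> topspace X" "x \<in> topspace X"
    using x(1) by (auto simp: \<theta>_def X_def)
  ultimately show ?thesis unfolding top_valid_def by blast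
qed

text \<open>The second conjunct extends soundness to spaces over every type, so that the class of
  all spaces is not confined to those on \<open>'a\<close>.\<close>

theorem theorem6p6:
  assumes "infinite (UNIV :: 'a set)"
  shows "(\<forall>A. A \<in> S4D \<longleftrightarrow> A \<in> D_logic (UNIV :: 'a topology set)) \<and>
         (\<forall>A. A \<in> S4D \<longrightarrow> A \<in> D_logic (UNIV :: 'b topology set))"
proof -
  have "A \<in> S4D" if "A \<in> D_logic (UNIV :: 'a topology set)" for A
  proof (rule ccontr)
    assume "A \<notin> S4D"
    then obtain X :: "'a topology" where "\<not> top_valid X A" using S4D_countermodel[OF assms] by blast
    then show False using that by (simp add: D_logic_def)
  qed
  then show ?thesis by (auto simp: D_logic_def intro: S4D_sound)
qed

end
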